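(* Let $(c_k)_{k\ge2}$ be a sequence of real numbers with $c_k\le 1$, decreasing to $1/2$ as $k\to\infty$. Let $n\ge1$, let $\mu_n$ denote the joint distribution on $I_n=\{0,1\}^n$ of a random vector $(x_1,\dots,x_n)$, and suppose that the conditional distributions satisfy $$\mu(x_k\mid x_1,\dots,x_{k-1})\le c_k\qquad(2\le k\le n)$$ for all values of $x_1,\dots,x_k\in\{0,1\}$, and that $\mu_1(0)=1/2$. Let $A\subset I_n$ be a non-empty set. Then for all $t>0$, $$\int_{I_n}e^{t\,d(x,A)}\,d\mu_n(x)\;\le\;\frac1{\mu_n(A)}\left(\frac12+\frac{e^t+e^{-t}}4\right)\left(\prod_{k=2}^n c_k^2\right)\left(2+e^t+e^{-t}\right)^{n-1}\;\le\;\frac1{\mu_n(A)}\left(4^{n-1}\prod_{k=2}^n c_k^2\right)e^{t^2n/4}.$$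
   Context: $I_n=\{0,1\}^n$ is equipped with the Hamming distance $d(x,y)=d_H(x,y)=\sum_{i=1}^n|x_i-y_i|$, and $d(x,A)=\min_{y\in A}d(x,y)$. $\mu_1$ is the distribution of $x_1$, and $\mu(x_k\mid x_1,\dots,x_{k-1})$ is the conditional probability, under $\mu_n$, that the $k$-th coordinate takes the value $x_k$ given the values $x_1,\dots,x_{k-1}$ of the first $k-1$ coordinates (the bound is required wherever this conditional probability is defined). If $\mu_n(A)=0$, then $1/\mu_n(A)$ is interpreted as $+\infty$. An empty product equals $1$. *)

theory Defs
  imports "HOL-Probability.Probability"
begin

text \<open>
  Points of \<open>I\<^sub>n = {0,1}\<^sup>n\<close> are functions that are \<open>undefined\<close> outside the
  index set \<open>{1..n}\<close>.
\<close>

definition cube :: "nat \<Rightarrow> (nat \<Rightarrow> int) set" where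
  "cube n = {1..n} \<rightarrow>\<^sub>E {0, 1}"

definition hamming :: "nat \<Rightarrow> (nat \<Rightarrow> int) \<Rightarrow> (nat \<Rightarrow> int) \<Rightarrow> int" where
  "hamming n x y = (\<Sum>i=1..n. \<bar>x i - y i\<bar>)"

text \<open>The minimum below is meaningful for finite non-empty \<open>A\<close> only.\<close>

definition hamming_set :: "nat \<Rightarrow> (nat \<Rightarrow> int) \<Rightarrow> (nat \<Rightarrow> int) set \<Rightarrow> int" where
  "hamming_set n x A = Min (hamming n x ` A)"

text \<open>
  The probability that the \<open>k\<close>-th coordinate is \<open>x k\<close> given that the coordinates
  \<open>1, \<dots>, k - 1\<close> agree with those of \<open>x\<close>. It is a genuine conditional probability only if
  \<open>prefix_prob \<mu> k x > 0\<close>; otherwise the quotient has the junk value \<open>0\<close>.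
\<close>

definition prefix_prob :: "(nat \<Rightarrow> int) pmf \<Rightarrow> nat \<Rightarrow> (nat \<Rightarrow> int) \<Rightarrow> real" where
  "prefix_prob \<mu> k x = \<P>(y in measure_pmf \<mu>. \<forall>i\<in>{1..<k}. y i = x i)"

definition coord_cond_prob :: "(nat \<Rightarrow> int) pmf \<Rightarrow> nat \<Rightarrow> (nat \<Rightarrow> int) \<Rightarrow> real" where
  "coord_cond_prob \<mu> k x =
     \<P>(y in measure_pmf \<mu>. y k = x k \<bar> \<forall>i\<in>{1..<k}. y i = x i)"

end

theory Submission imports Defs begin

text \<open>
  The hypotheses force the pointwise bound \<open>\<mu>(x) \<le> 1/2 \<cdot> c\<^sub>2 \<cdots> c\<^sub>n\<close>. Applying it both to \<open>\<mu>(A)\<close> and to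
  the integral reduces the first inequality to the one for the counting measure,
  \<open>card A \<cdot> (\<Sum>x. exp (t d(x,A))) \<le> (2 + exp t + exp (-t))\<^sup>n\<close>, which follows by induction on \<open>n\<close>
  after slicing \<open>A\<close> along the last coordinate. The second inequality is
  \<open>cosh (t/2)\<^sup>2 \<le> exp (t\<^sup>2/4)\<close>.
\<close>

section \<open>Splitting the cube and its subsets along the last coordinate\<close>

lemma finite_cube [simp]: "finite (cube n)"
  unfolding cube_def by (intro finite_PiE) auto

lemma cube_0: "cube 0 = {\<lambda>_. undefined}"
  by (simp add: cube_def)

lemma cube_Suc: "cube (Suc n) = (\<lambda>(b, x). x(Suc n := b)) ` ({0, 1} \<times> cube n)"
proof -
  have "{1..Suc n} = insert (Suc n) {1..n}" by auto
  then show ?thesis unfolding cube_def by (simp only: PiE_insert_eq)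
qed

lemma inj_on_cube_update: "inj_on (\<lambda>(b, x). x(Suc n := b)) ({0, 1} \<times> cube n)"
  unfolding cube_def by (rule inj_combinator) simp

lemma sum_cube_Suc:
  fixes f :: "(nat \<Rightarrow> int) \<Rightarrow> 'a :: comm_monoid_add"
  shows "(\<Sum>x\<in>cube (Suc n). f x) = (\<Sum>x\<in>cube n. f (x(Suc n := 0))) + (\<Sum>x\<in>cube n. f (x(Suc n := 1)))"
proof -
  have "(\<Sum>x\<in>cube (Suc n). f x) = (\<Sum>(b, x)\<in>{0, 1} \<times> cube n. f (x(Suc n := b)))"
    unfolding cube_Suc sum.reindex[OF inj_on_cube_update] by (simp add: case_prod_unfold)
  also have "\<dots> = (\<Sum>b\<in>{0, 1}. \<Sum>x\<in>cube n. f (x(Suc n := b)))"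
    by (simp add: sum.cartesian_product)
  finally show ?thesis by simp
qed

text \<open>The last coordinate is dropped, so that a slice lies in \<open>cube n\<close> and the
  induction hypothesis applies to it.\<close>

definition slice :: "nat \<Rightarrow> int \<Rightarrow> (nat \<Rightarrow> int) set \<Rightarrow> (nat \<Rightarrow> int) set" where
  "slice n b A = {x \<in> cube n. x(Suc n := b) \<in> A}"

lemma finite_slice [simp]: "finite (slice n b A)"
  by (simp add: slice_def)

lemma card_slices:
  assumes "A \<subseteq> cube (Suc n)"
  shows "card A = card (slice n 0 A) + card (slice n 1 A)"
proof -
  \<comment> \<open>Cardinalities become sums of indicators over a cube, which brings
    \<open>sum_cube_Suc\<close> into play.\<close>
  have card_eq: "card B = (\<Sum>x\<in>C. if x \<in> B then 1 else 0)" if "B \<subseteq> C" "finite C"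
    for B C :: "(nat \<Rightarrow> int) set"
    using that by (simp add: sum.If_cases inf.absorb2)
  have slice_sum: "card (slice n b A) = (\<Sum>x\<in>cube n. if x(Suc n := b) \<in> A then 1 else 0)" for b
    by (subst card_eq[of _ "cube n"]) (auto simp: slice_def intro!: sum.cong)
  show ?thesis
    unfolding slice_sum by (subst card_eq[OF assms finite_cube]) (rule sum_cube_Suc)
qed

lemma hamming_update:
  "hamming (Suc n) (x(Suc n := a)) (y(Suc n := b)) = hamming n x y + \<bar>a - b\<bar>"
  by (simp add: hamming_def)

text \<open>A nearest point of the slice, with the coordinate \<open>b\<close> appended, belongs to
  \<open>A\<close>; changing the last coordinate costs the extra
  \<open>\<bar>a - b\<bar>\<close>.\<close>

lemma hamming_set_update_le:
  assumes "A \<subseteq> cube (Suc n)" "slice n b A \<noteq> {}"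
  shows "hamming_set (Suc n) (x(Suc n := a)) A \<le> hamming_set n x (slice n b A) + \<bar>a - b\<bar>"
proof -
  have "hamming_set n x (slice n b A) \<in> hamming n x ` slice n b A"
    unfolding hamming_set_def using assms by (intro Min_in) auto
  then obtain y where y: "y \<in> slice n b A" "hamming_set n x (slice n b A) = hamming n x y"
    by auto
  have "finite A" using assms(1) finite_cube by (rule finite_subset)
  then have "hamming_set (Suc n) (x(Suc n := a)) A \<le> hamming (Suc n) (x(Suc n := a)) (y(Suc n := b))"
    unfolding hamming_set_def using y by (intro Min_le) (auto simp: slice_def)
  then show ?thesis using y by (simp add: hamming_update)
qed

section \<open>The inequality for the counting measure\<close>

text \<open>Under the constraint on the product, the sum is largest when one term is
  \<open>E * K\<close> and the other \<open>K / E\<close>. This improves on the bound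
  \<open>2 * E * K\<close> that adding the separate estimates would give.\<close>

lemma add_le_of_mult_le:
  fixes X Y E K :: real
  assumes "0 < K" "0 < E" "X \<le> E * K" "Y \<le> E * K" "X * Y \<le> K\<^sup>2"
  shows "X + Y \<le> K * (E + 1 / E)"
proof (cases "X \<le> K / E")
  case True
  with assms show ?thesis by (simp add: algebra_simps)
next
  case False
  then have "K / E < X" by simp
  moreover have "0 < K / E" using assms by simp
  ultimately have X: "0 < X" by simp
  \<comment> \<open>This quadratic in \<open>X\<close> has the roots \<open>K / E\<close> and
    \<open>E * K\<close>, and \<open>X\<close> lies between them.\<close>
  have "0 \<le> (E * K - X) * (X - K / E)"
    using assms \<open>K / E < X\<close> by (intro mult_nonneg_nonneg) auto
  also have "\<dots> = X * (K * (E + 1 / E)) - (X\<^sup>2 + K\<^sup>2)"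
    using assms by (simp add: field_simps power2_eq_square)
  also have "\<dots> \<le> X * (K * (E + 1 / E)) - (X\<^sup>2 + X * Y)"
    using assms by simp
  also have "\<dots> = X * (K * (E + 1 / E) - (X + Y))"
    by (simp add: algebra_simps power2_eq_square)
  finally show ?thesis using X by (simp add: zero_le_mult_iff)
qed

text \<open>With \<open>m b\<close> the size of a slice and \<open>S a\<close> the sum over a face,
  expand \<open>(m 0 + m 1) * (S 0 + S 1)\<close>. The two diagonal terms contribute at most
  \<open>2 * K\<close>, the two mixed ones at most \<open>K * (exp t + exp (- t))\<close>, which is
  one more factor of the power.\<close>

lemma card_sum_exp_hamming_set_le:
  assumes "A \<subseteq> cube n" "0 \<le> t"
  shows "real (card A) * (\<Sum>x\<in>cube n. exp (t * real_of_int (hamming_set n x A)))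
           \<le> (2 + exp t + exp (- t)) ^ n"
  using assms(1)
proof (induction n arbitrary: A)
  case 0
  then consider "A = {}" | "A = cube 0" by (auto simp: cube_0 subset_singleton_iff)
  then show ?case
    by cases (simp_all add: cube_0 hamming_set_def hamming_def)
next
  case (Suc n)
  define K where "K = (2 + exp t + exp (- t)) ^ n"
  define S where "S a = (\<Sum>x\<in>cube n. exp (t * real_of_int (hamming_set (Suc n) (x(Suc n := a)) A)))" for a
  define m where "m b = real (card (slice n b A))" for b
  have K: "0 < K" unfolding K_def by (simp add: add_pos_pos)
  have bound: "m b * S a \<le> exp (t * \<bar>real_of_int (a - b)\<bar>) * K" for a b
  proof (cases "slice n b A = {}")
    \<comment> \<open>The distance to an empty slice is unspecified, but the factor
      \<open>m b\<close> is zero.\<close>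
    case True
    then show ?thesis using K by (simp add: m_def)
  next
    case False
    have "S a \<le> (\<Sum>x\<in>cube n. exp (t * \<bar>real_of_int (a - b)\<bar>)
                               * exp (t * real_of_int (hamming_set n x (slice n b A))))"
      unfolding S_def
    proof (rule sum_mono)
      fix x
      have "real_of_int (hamming_set (Suc n) (x(Suc n := a)) A)
              \<le> \<bar>real_of_int (a - b)\<bar> + real_of_int (hamming_set n x (slice n b A))"
        using hamming_set_update_le[OF Suc.prems False, of x a] by linarith
      then have "t * real_of_int (hamming_set (Suc n) (x(Suc n := a)) A)
              \<le> t * \<bar>real_of_int (a - b)\<bar> + t * real_of_int (hamming_set n x (slice n b A))"
        using \<open>0 \<le> t\<close> by (metis distrib_left mult_left_mono)
      then show "exp (t * real_of_int (hamming_set (Suc n) (x(Suc n := a)) A))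
              \<le> exp (t * \<bar>real_of_int (a - b)\<bar>) * exp (t * real_of_int (hamming_set n x (slice n b A)))"
        by (simp flip: exp_add)
    qed
    then have "m b * S a \<le> exp (t * \<bar>real_of_int (a - b)\<bar>)
        * (m b * (\<Sum>x\<in>cube n. exp (t * real_of_int (hamming_set n x (slice n b A)))))"
      by (auto simp: m_def mult_left_mono mult.left_commute simp flip: sum_distrib_left)
    also have "\<dots> \<le> exp (t * \<bar>real_of_int (a - b)\<bar>) * K"
      unfolding m_def K_def by (intro mult_left_mono Suc.IH) (auto simp: slice_def)
    finally show ?thesis .
  qed
  have b00: "m 0 * S 0 \<le> K" and b11: "m 1 * S 1 \<le> K"
    using bound[of 0 0] bound[of 1 1] by simp_all
  have nonneg: "0 \<le> m b" "0 \<le> S b" for b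
    by (auto simp: m_def S_def intro: sum_nonneg)
  \<comment> \<open>The two mixed terms have the same product as the two diagonal ones, which is the
    constraint that \<open>add_le_of_mult_le\<close> requires, with
    \<open>E = exp t\<close>.\<close>
  have "(m 0 * S 0) * (m 1 * S 1) \<le> K * K"
    using b00 b11 nonneg K by (intro mult_mono) auto
  then have "m 1 * S 0 + m 0 * S 1 \<le> K * (exp t + 1 / exp t)"
    using bound[of 1 0] bound[of 0 1] K
    by (intro add_le_of_mult_le) (auto simp: power2_eq_square algebra_simps)
  then have "(m 0 + m 1) * (S 0 + S 1) \<le> K * (2 + exp t + exp (- t))"
    using b00 b11 by (simp add: algebra_simps exp_minus divide_inverse)
  then show ?case
    unfolding card_slices[OF Suc.prems] sum_cube_Suc by (simp add: m_def S_def K_def mult.commute)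
qed

section \<open>The Gaussian bound\<close>

lemma two_plus_exp_le:
  fixes t :: real
  assumes "0 \<le> t"
  shows "2 + exp t + exp (- t) \<le> 4 * exp (t\<^sup>2 / 4)"
proof -
  \<comment> \<open>The left side is the logarithm of the moment generating function of a centred
    fair coin, that is \<open>ln (cosh (t / 2))\<close>.\<close>
  have "- t * (1 / 2) + ln (1 + (1 / 2) * (exp t - 1)) \<le> t\<^sup>2 / 8"
    using Hoeffdings_lemma_aux[of t "1 / 2"] assms by simp
  then have "ln ((1 + exp t) / 2) \<le> t\<^sup>2 / 8 + t / 2"
    by (simp add: field_simps)
  then have "exp (ln ((1 + exp t) / 2)) \<le> exp (t\<^sup>2 / 8 + t / 2)"
    by simp
  moreover have "0 < (1 + exp t) / 2" by (simp add: add_pos_pos)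
  ultimately have "(1 + exp t) / 2 \<le> exp (t\<^sup>2 / 8 + t / 2)"
    by (simp only: exp_ln)
  then have "((1 + exp t) / 2)\<^sup>2 \<le> (exp (t\<^sup>2 / 8 + t / 2))\<^sup>2"
    by (intro power_mono) auto
  also have "\<dots> = exp (t\<^sup>2 / 4) * exp t"
    by (simp add: algebra_simps flip: exp_double exp_add)
  finally have "(1 + exp t)\<^sup>2 \<le> 4 * exp (t\<^sup>2 / 4) * exp t"
    by (simp add: field_simps)
  then have "(1 + exp t)\<^sup>2 / exp t \<le> 4 * exp (t\<^sup>2 / 4)"
    by (simp add: pos_divide_le_eq)
  moreover have "(1 + exp t)\<^sup>2 / exp t = 2 + exp t + exp (- t)"
    by (simp add: exp_minus field_simps power2_eq_square)
  ultimately show ?thesis by simp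
qed

section \<open>From conditional probabilities to prefix probabilities\<close>

text \<open>This is the chain rule where the conditioning event has positive probability; where it
  is null, both sides vanish.\<close>

lemma prefix_prob_Suc_le:
  assumes "prefix_prob \<mu> k x > 0 \<Longrightarrow> coord_cond_prob \<mu> k x \<le> c" "1 \<le> k"
  shows "prefix_prob \<mu> (Suc k) x \<le> c * prefix_prob \<mu> k x"
proof -
  have eq: "(\<forall>i\<in>{1..<Suc k}. y i = x i) \<longleftrightarrow> y k = x k \<and> (\<forall>i\<in>{1..<k}. y i = x i)" for y :: "nat \<Rightarrow> int"
    using assms(2) by (auto simp: atLeastLessThanSuc)
  show ?thesis
  proof (cases "prefix_prob \<mu> k x > 0")
    case True
    then have "prefix_prob \<mu> (Suc k) x = coord_cond_prob \<mu> k x * prefix_prob \<mu> k x"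
      unfolding coord_cond_prob_def cond_prob_def prefix_prob_def eq by simp
    then show ?thesis using assms(1)[OF True] True by simp
  next
    case False
    moreover have "prefix_prob \<mu> (Suc k) x \<le> prefix_prob \<mu> k x"
      unfolding prefix_prob_def eq by (intro measure_pmf.finite_measure_mono) auto
    moreover have "0 \<le> prefix_prob \<mu> k x" by (simp add: prefix_prob_def)
    ultimately show ?thesis by simp
  qed
qed

text \<open>Only coordinate 1 is prescribed here. It is almost surely 0 or 1, so the value 1 takes
  the half of the mass that the value 0 leaves.\<close>

lemma prefix_prob_two:
  assumes "set_pmf \<mu> \<subseteq> cube n" "1 \<le> n" "x \<in> cube n"
    and "pmf (map_pmf (\<lambda>x. x 1) \<mu>) 0 = 1 / 2"
  shows "prefix_prob \<mu> 2 x = 1 / 2"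
proof -
  define M where "M b = measure (measure_pmf \<mu>) {y. y 1 = b}" for b :: int
  have M0: "M 0 = 1 / 2"
    using assms(4) by (simp add: M_def pmf_map vimage_def)
  have "y 1 = 0 \<or> y 1 = 1" if "y \<in> set_pmf \<mu>" for y
  proof -
    have "y 1 \<in> {0, 1}"
      using that assms(1,2) unfolding cube_def by (intro PiE_mem[of y "{1..n}"]) auto
    then show ?thesis by simp
  qed
  then have "M 1 = measure (measure_pmf \<mu>) (- {y. y 1 = 0})"
    unfolding M_def
    by (intro measure_pmf.finite_measure_eq_AE) (auto simp: AE_measure_pmf_iff)
  also have "\<dots> = 1 - M 0"
    unfolding M_def using measure_pmf.prob_compl[of "{y. y 1 = (0::int)}" \<mu>]
    by (simp add: Compl_eq_Diff_UNIV)
  finally have M1: "M 1 = 1 / 2" using M0 by simp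
  have "x 1 = 0 \<or> x 1 = 1"
    using assms(2,3) by (auto simp: cube_def PiE_iff)
  moreover have "prefix_prob \<mu> 2 x = M (x 1)"
    by (simp add: prefix_prob_def M_def numeral_2_eq_2)
  ultimately show ?thesis using M0 M1 by auto
qed

theorem theorem7:
  fixes c :: "nat \<Rightarrow> real" and n :: nat and \<mu> :: "(nat \<Rightarrow> int) pmf"
    and A :: "(nat \<Rightarrow> int) set" and t :: real
  assumes c_le_1: "\<And>k. 2 \<le> k \<Longrightarrow> c k \<le> 1"
    and c_decreasing: "antimono_on {2..} c"
    and c_limit: "c \<longlonglongrightarrow> 1 / 2"
    and n: "1 \<le> n"
    and on_cube: "set_pmf \<mu> \<subseteq> cube n"
    and cond_bound: "\<And>k x. 2 \<le> k \<Longrightarrow> k \<le> n \<Longrightarrow> x \<in> cube n \<Longrightarrow> prefix_prob \<mu> k x > 0 \<Longrightarrow>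
                       coord_cond_prob \<mu> k x \<le> c k"
    and first_coord: "pmf (map_pmf (\<lambda>x. x 1) \<mu>) 0 = 1 / 2"
    and A: "A \<subseteq> cube n" "A \<noteq> {}"
    and t: "0 < t"
  shows "(\<integral>\<^sup>+ x. ennreal (exp (t * real_of_int (hamming_set n x A))) \<partial>measure_pmf \<mu>)
           \<le> 1 / emeasure (measure_pmf \<mu>) A *
              ennreal ((1 / 2 + (exp t + exp (- t)) / 4) * (\<Prod>k=2..n. (c k)\<^sup>2) *
                       (2 + exp t + exp (- t)) ^ (n - 1))
       \<and> 1 / emeasure (measure_pmf \<mu>) A *
              ennreal ((1 / 2 + (exp t + exp (- t)) / 4) * (\<Prod>k=2..n. (c k)\<^sup>2) *
                       (2 + exp t + exp (- t)) ^ (n - 1))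
           \<le> 1 / emeasure (measure_pmf \<mu>) A *
              ennreal ((4 ^ (n - 1) * (\<Prod>k=2..n. (c k)\<^sup>2)) * exp (t\<^sup>2 * real n / 4))"
proof -
  define s where "s = 2 + exp t + exp (- t)"
  define p where "p = (\<Prod>k=2..n. c k)"
  define L where "L = (\<Sum>x\<in>cube n. exp (t * real_of_int (hamming_set n x A)) * pmf \<mu> x)"
  define m where "m = (\<Sum>x\<in>A. pmf \<mu> x)"
  \<comment> \<open>As \<open>1 / 2 + (exp t + exp (- t)) / 4 = s / 4\<close>, this is the middle
    expression without the factor \<open>1 / \<mu>(A)\<close>; it equals
    \<open>(p / 2)\<^sup>2 * s ^ n\<close>.\<close>
  define C where "C = s / 4 * (\<Prod>k=2..n. (c k)\<^sup>2) * s ^ (n - 1)"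
  \<comment> \<open>A decreasing sequence stays above its limit. The resulting positivity of
    \<open>c k\<close> allows the conditional bounds to be multiplied.\<close>
  have c_ge: "1 / 2 \<le> c k" if "2 \<le> k" for k
  proof (rule LIMSEQ_le_const2[OF c_limit])
    show "\<exists>N. \<forall>j\<ge>N. c j \<le> c k"
      using c_decreasing that by (intro exI[of _ k]) (auto simp: monotone_on_def)
  qed
  have c_pos: "0 < c k" if "2 \<le> k" for k using c_ge[OF that] by linarith
  have s: "0 < s" by (simp add: s_def add_pos_pos)
  have p: "0 < p" unfolding p_def by (intro prod_pos) (auto intro: c_pos)
  have "0 < (\<Prod>k=2..n. (c k)\<^sup>2)" by (intro prod_pos) (auto dest: c_pos)
  then have C: "0 < C" unfolding C_def using s by simp
  have pmf_le: "pmf \<mu> x \<le> p / 2" if x: "x \<in> cube n" for x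
  proof -
    \<comment> \<open>The index \<open>Suc k\<close> prescribes exactly the coordinates 1 to
      \<open>k\<close>; for \<open>k = 1\<close> the product is empty.\<close>
    have "prefix_prob \<mu> (Suc k) x \<le> 1 / 2 * (\<Prod>j=2..k. c j)" if "1 \<le> k" "k \<le> n" for k
      using that
    proof (induction k rule: dec_induct)
      case base
      then show ?case
        using prefix_prob_two[OF on_cube n x first_coord] by (simp add: numeral_2_eq_2)
    next
      case (step k)
      then have k: "2 \<le> Suc k" "Suc k \<le> n" by auto
      have "prefix_prob \<mu> (Suc (Suc k)) x \<le> c (Suc k) * prefix_prob \<mu> (Suc k) x"
        using k x by (intro prefix_prob_Suc_le cond_bound) auto
      also have "\<dots> \<le> c (Suc k) * (1 / 2 * (\<Prod>j=2..k. c j))"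
        using step k c_pos[of "Suc k"] by (intro mult_left_mono) auto
      also have "\<dots> = 1 / 2 * (\<Prod>j=2..Suc k. c j)"
        using k by (simp add: prod.nat_ivl_Suc')
      finally show ?case .
    qed
    from this[OF n] have "prefix_prob \<mu> (Suc n) x \<le> p / 2" by (simp add: p_def)
    moreover have "pmf \<mu> x \<le> prefix_prob \<mu> (Suc n) x"
      unfolding prefix_prob_def measure_pmf_single[symmetric]
      by (intro measure_pmf.finite_measure_mono) auto
    ultimately show ?thesis by simp
  qed
  have finA: "finite A" using A(1) finite_cube by (rule finite_subset)
  have m_nonneg: "0 \<le> m" by (simp add: m_def sum_nonneg)
  have "m \<le> real (card A) * (p / 2)"
    unfolding m_def using A(1) by (intro sum_bounded_above pmf_le) blast
  moreover have "L \<le> (\<Sum>x\<in>cube n. exp (t * real_of_int (hamming_set n x A))) * (p / 2)"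
    unfolding L_def sum_distrib_right by (intro sum_mono mult_left_mono pmf_le) auto
  moreover have "0 \<le> L" by (auto simp: L_def intro: sum_nonneg)
  ultimately have "m * L \<le> (real (card A) * (p / 2))
      * ((\<Sum>x\<in>cube n. exp (t * real_of_int (hamming_set n x A))) * (p / 2))"
    using p by (intro mult_mono) auto
  also have "\<dots> = (p / 2)\<^sup>2 * (real (card A) * (\<Sum>x\<in>cube n. exp (t * real_of_int (hamming_set n x A))))"
    by (simp add: power2_eq_square algebra_simps)
  also have "\<dots> \<le> (p / 2)\<^sup>2 * s ^ n"
    unfolding s_def using A t by (intro mult_left_mono card_sum_exp_hamming_set_le) auto
  also have "\<dots> = C"
  proof -
    have "s ^ n = s * s ^ (n - 1)" using n by (cases n) auto
    moreover have "p\<^sup>2 = (\<Prod>k=2..n. (c k)\<^sup>2)" by (simp add: p_def prod_power_distrib)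
    ultimately show ?thesis by (simp add: C_def power_divide)
  qed
  finally have mL: "m * L \<le> C" .
  have emeasure_A: "emeasure (measure_pmf \<mu>) A = ennreal m"
    unfolding m_def by (rule emeasure_measure_pmf_finite[OF finA])
  have integral: "(\<integral>\<^sup>+ x. ennreal (exp (t * real_of_int (hamming_set n x A))) \<partial>measure_pmf \<mu>) = ennreal L"
    using on_cube unfolding L_def
    by (subst nn_integral_measure_pmf_support[of "cube n"])
       (auto simp: sum_ennreal ennreal_mult simp flip: ennreal_mult)
  have C_eq: "(1 / 2 + (exp t + exp (- t)) / 4) * (\<Prod>k=2..n. (c k)\<^sup>2) * (2 + exp t + exp (- t)) ^ (n - 1) = C"
    by (simp add: C_def s_def add_divide_distrib)
  have first: "ennreal L \<le> 1 / ennreal m * ennreal C"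
  proof (cases "m = 0")
    \<comment> \<open>Here \<open>1 / 0\<close> is infinite, and it stays infinite after
      multiplication because \<open>C\<close> is positive.\<close>
    case True
    then show ?thesis using C by (simp add: ennreal_top_mult)
  next
    case False
    then have "0 < m" using m_nonneg by simp
    then have "1 / ennreal m * ennreal C = ennreal (C / m)"
      using C by (simp add: ennreal_divide_times divide_ennreal)
    moreover have "L \<le> C / m" using mL \<open>0 < m\<close> by (simp add: field_simps)
    ultimately show ?thesis by (simp add: ennreal_leI)
  qed
  have "s ^ n \<le> (4 * exp (t\<^sup>2 / 4)) ^ n"
    using two_plus_exp_le[of t] t s by (intro power_mono) (auto simp: s_def)
  also have "\<dots> = 4 ^ n * exp (t\<^sup>2 * real n / 4)"
    by (simp add: power_mult_distrib mult.commute flip: exp_of_nat_mult)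
  \<comment> \<open>The left side is a quarter of \<open>s ^ n\<close>, so one of the
    \<open>n\<close> factors 4 on the right cancels.\<close>
  finally have "s / 4 * s ^ (n - 1) \<le> 4 ^ (n - 1) * exp (t\<^sup>2 * real n / 4)"
    using n by (cases n) simp_all
  then have "(\<Prod>k=2..n. (c k)\<^sup>2) * (s / 4 * s ^ (n - 1))
      \<le> (\<Prod>k=2..n. (c k)\<^sup>2) * (4 ^ (n - 1) * exp (t\<^sup>2 * real n / 4))"
    by (intro mult_left_mono prod_nonneg) auto
  then have second: "C \<le> (4 ^ (n - 1) * (\<Prod>k=2..n. (c k)\<^sup>2)) * exp (t\<^sup>2 * real n / 4)"
    by (simp add: C_def algebra_simps)
  show ?thesis
    unfolding C_eq emeasure_A integral
    using first second by (auto intro: mult_left_mono ennreal_leI)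
qed

end
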